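(* Let $\mathcal{C}$ be either $\{\sigma:\mathbf{S}(\mathbf{S}(\sigma))=\mathrm{id}\}$ or $\{\sigma:\mathbf{S}(\mathbf{r}(\mathbf{S}(\sigma)))=\mathrm{id}\}$. Then for every $\pi\in\mathcal{C}$ of size $n\ge 2$, the permutation obtained by deleting the last letter of $\pi$ and normalizing lies in $\mathcal{C}$; the permutation $1$ has label $(2,1,(1))$; and for every $\pi\in\mathcal{C}$ with label $(x,k,(p_1,\dots,p_k))$, the multiset of labels of its children is exactly $\{(2+p_j,\,j,\,(p_1,\dots,p_{j-1},i)) : 1\le j\le k,\ p_{j-1}<i\le p_j\}\ \cup\ \{(x+1,\,k+1,\,(p_1,\dots,p_k,i)) : p_k<i\le x\}$, with the convention $p_0=0$.
   Context: The stack sorting operator: $\mathbf{S}(\varepsilon)=\varepsilon$, $\mathbf{S}(LmR)=\mathbf{S}(L)\mathbf{S}(R)m$ with $m$ the maximum letter of $LmR$; $\mathbf{r}$ is reversal of a word; $\mathrm{id}=12\cdots n$. For $\pi\in\mathcal{C}$ of size $n$ and $t\in\{0,1,\dots,n\}$ (the "site" at height between values $t$ and $t+1$, to the right of $\pi$), let $\pi^{(t)}$ be the permutation of size $n+1$ with last letter $t+1$ whose first $n$ letters are $\pi$ with every value $\ge t+1$ increased by $1$ (insertion rule "Rightmost"). The site $t$ is active if $\pi^{(t)}\in\mathcal{C}$; the children of $\pi$ are the $\pi^{(t)}$ for active sites $t$. A site $t$ is above a value $v$ if $t\ge v$. The label of $\pi$ is $(x,k,(p_1,\dots,p_k))$ where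 $x$ is the number of active sites of $\pi$, $k$ is the number of right-to-left maxima of $\pi$ (entries larger than all entries to their right), and, listing the values of the right-to-left maxima in decreasing order $v_1>v_2>\dots>v_k$, $p_\ell$ is the number of active sites above $v_\ell$. *)

theory Defs
  imports "HOL-Combinatorics.Multiset_Permutations"
begin

text \<open>Words are lists. The word is split at the first occurrence of its maximum letter; for
  permutations, which are the only words of interest, this is the unique occurrence.\<close>

function stack_sort :: "'a::linorder list \<Rightarrow> 'a list" where
  "stack_sort w =
     (if w = [] then []
      else let m = Max (set w)
           in stack_sort (takeWhile (\<lambda>a. a \<noteq> m) w)
              @ stack_sort (tl (dropWhile (\<lambda>a. a \<noteq> m) w)) @ [m])"
  by pat_completeness auto
termination
proof (relation "measure length", goal_cases)
  case 1
  show ?case by simp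
next
  case (2 w m)
  then have "m \<in> set w" by simp
  then have "dropWhile (\<lambda>a. a \<noteq> m) w \<noteq> []"
    by (simp only: dropWhile_eq_Nil_conv) blast
  moreover have "length (takeWhile (\<lambda>a. a \<noteq> m) w) + length (dropWhile (\<lambda>a. a \<noteq> m) w) = length w"
    by (simp only: length_append [symmetric] takeWhile_dropWhile_id)
  ultimately have "length (takeWhile (\<lambda>a. a \<noteq> m) w) < length w"
    by (simp only: length_greater_0_conv [symmetric])
  then show ?case by simp
next
  case (3 w m)
  then have "length w > 0" by simp
  then have "length (dropWhile (\<lambda>a. a \<noteq> m) w) - 1 < length w"
    using length_dropWhile_le[of "\<lambda>a. a \<noteq> m" w] by linarith
  then show ?case by simp
qed

declare stack_sort.simps [simp del]

definition is_perm :: "nat list \<Rightarrow> bool" where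
  "is_perm \<sigma> \<longleftrightarrow> \<sigma> \<in> permutations_of_set {1..length \<sigma>}"

definition id_perm :: "nat \<Rightarrow> nat list" where
  "id_perm n = [1..<Suc n]"

definition class_SS :: "nat list set" where
  "class_SS = {\<sigma>. is_perm \<sigma> \<and> stack_sort (stack_sort \<sigma>) = id_perm (length \<sigma>)}"

definition class_SrS :: "nat list set" where
  "class_SrS = {\<sigma>. is_perm \<sigma> \<and> stack_sort (rev (stack_sort \<sigma>)) = id_perm (length \<sigma>)}"

text \<open>Each letter is replaced by its rank among the letters of the word.\<close>

definition normalize_word :: "nat list \<Rightarrow> nat list" where
  "normalize_word w = map (\<lambda>v. card {u \<in> set w. u \<le> v}) w"

definition insert_right :: "nat list \<Rightarrow> nat \<Rightarrow> nat list" where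
  "insert_right \<pi> t = map (\<lambda>v. if v \<ge> t + 1 then v + 1 else v) \<pi> @ [t + 1]"

definition active_sites :: "nat list set \<Rightarrow> nat list \<Rightarrow> nat set" where
  "active_sites C \<pi> = {t \<in> {0..length \<pi>}. insert_right \<pi> t \<in> C}"

definition children :: "nat list set \<Rightarrow> nat list \<Rightarrow> nat list set" where
  "children C \<pi> = insert_right \<pi> ` active_sites C \<pi>"

definition rl_maxima :: "nat list \<Rightarrow> nat set" where
  "rl_maxima \<pi> = {\<pi> ! i | i. i < length \<pi> \<and> (\<forall>j. i < j \<and> j < length \<pi> \<longrightarrow> \<pi> ! j < \<pi> ! i)}"

definition sites_above :: "nat list set \<Rightarrow> nat list \<Rightarrow> nat \<Rightarrow> nat set" where
  "sites_above C \<pi> v = {t \<in> active_sites C \<pi>. t \<ge> v}"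

definition label :: "nat list set \<Rightarrow> nat list \<Rightarrow> nat \<times> nat \<times> nat list" where
  "label C \<pi> =
     (card (active_sites C \<pi>),
      card (rl_maxima \<pi>),
      map (\<lambda>v. card (sites_above C \<pi> v)) (rev (sorted_list_of_set (rl_maxima \<pi>))))"

text \<open>The right-hand side of the rewriting rule. The list \<open>p\<close> is indexed from 0, so
  \<open>(0 # p) ! j\<close> is $p_j$ with the convention $p_0 = 0$, and \<open>take (j - 1) p\<close> is
  $(p_1, \dots, p_{j-1})$.\<close>

definition successor_labels ::
    "nat \<Rightarrow> nat \<Rightarrow> nat list \<Rightarrow> (nat \<times> nat \<times> nat list) multiset" where
  "successor_labels x k p =
     {# (2 + (0 # p) ! j, j, take (j - 1) p @ [i]).
          (j, i) \<in># mset_set (SIGMA j:{1..k}. {(0 # p) ! (j - 1)<..(0 # p) ! j}) #}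
     + {# (x + 1, k + 1, p @ [i]). i \<in># mset_set {(0 # p) ! k<..x} #}"

end

theory Submission
  imports Defs
begin

text \<open>Both classes consist of the permutations \<open>\<pi>\<close> for which \<open>S(\<pi>)\<close> avoids a pattern of length 3,
  namely 231 or 132. The word \<open>S(\<pi>)\<close> ends with the right-to-left maxima \<open>v\<^sub>k < \<dots> < v\<^sub>1\<close> of \<open>\<pi>\<close>,
  and appending a last letter to \<open>\<pi>\<close> inserts this letter in \<open>S(\<pi>)\<close> in front of the smallest
  \<open>v\<^sub>j\<close> exceeding it. The letter can only be the last one of an occurrence of the pattern, and the
  other two come from the part of \<open>S(\<pi>)\<close> before \<open>v\<^sub>k\<close>. Inserting at an active site \<open>t\<close> with
  \<open>v\<^sub>j \<le> t < v\<^bsub>j-1\<^esub>\<close> moves \<open>v\<^sub>k, \<dots>, v\<^sub>j\<close> to this part. This keeps the activity of all sites above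
  \<open>v\<^sub>j\<close>, makes all sites below \<open>v\<^sub>j\<close> inactive except for one (\<open>v\<^sub>j - 1\<close> for 231 and 0 for 132), and
  the site \<open>t\<close> is split in two.\<close>

declare sorted_list_of_set.sorted_key_list_of_set_insert_remove [simp del]
  sorted_list_of_set.sorted_key_list_of_set_insert [simp del]

section \<open>Stack sorting of words with distinct letters\<close>

lemma stack_sort_Nil [simp]: "stack_sort [] = []"
  by (simp add: stack_sort.simps)

lemma stack_sort_append_max:
  assumes "\<forall>x\<in>set L \<union> set R. x < m"
  shows "stack_sort (L @ m # R) = stack_sort L @ stack_sort R @ [m]"
proof -
  have m: "Max (set (L @ m # R)) = m"
    using assms by (intro Max_eqI) (auto intro: less_imp_le)
  have "m \<notin> set L" using assms by auto
  then have "takeWhile (\<lambda>a. a \<noteq> m) (L @ m # R) = L" "dropWhile (\<lambda>a. a \<noteq> m) (L @ m # R) = m # R"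
    by (auto simp: takeWhile_append dropWhile_append)
  with m show ?thesis by (subst stack_sort.simps) (simp add: Let_def)
qed

text \<open>The scheme mirrors the recursion of \<open>stack_sort\<close>. Distinctness puts all
  letters other than \<open>m\<close> strictly below \<open>m\<close>, so
  \<open>stack_sort_append_max\<close> applies in every step.\<close>

lemma distinct_max_induct [consumes 1, case_names Nil max]:
  fixes w :: "'a::linorder list"
  assumes "distinct w" and "P []"
    and step: "\<And>L m R. distinct (L @ m # R) \<Longrightarrow> \<forall>x\<in>set L \<union> set R. x < m \<Longrightarrow>
      P L \<Longrightarrow> P R \<Longrightarrow> P (L @ m # R)"
  shows "P w"
  using assms(1)
proof (induction w rule: length_induct)
  case (1 w)
  show ?case
  proof (cases "w = []")
    case False
    define m where "m = Max (set w)"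
    then have "m \<in> set w" using False by simp
    then obtain L R where w: "w = L @ m # R" by (meson split_list)
    have le: "\<forall>x\<in>set w. x \<le> m" by (simp add: m_def)
    have "\<forall>x\<in>set L \<union> set R. x < m"
    proof
      fix x assume "x \<in> set L \<union> set R"
      then have "x \<le> m" "x \<noteq> m" using le 1(2) w by auto
      then show "x < m" by simp
    qed
    with 1 w show ?thesis by (auto intro!: step)
  qed (simp add: assms(2))
qed

lemma sorted_wrt_if_all:
  assumes "\<And>x y. x \<in> set w \<Longrightarrow> y \<in> set w \<Longrightarrow> P x y"
  shows "sorted_wrt P w"
  using assms by (auto simp: sorted_wrt_iff_nth_less)

lemma mset_stack_sort [simp]:
  assumes "distinct w"
  shows "mset (stack_sort w) = mset w"
  using assms by (induction rule: distinct_max_induct) (auto simp: stack_sort_append_max)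

lemma set_stack_sort [simp]:
  assumes "distinct w"
  shows "set (stack_sort w) = set w"
  using assms by (metis mset_stack_sort set_mset_mset)

lemma distinct_stack_sort:
  assumes "distinct w"
  shows "distinct (stack_sort w)"
  using assms by (metis mset_stack_sort mset_eq_imp_distinct_iff)

lemma length_stack_sort:
  assumes "distinct w"
  shows "length (stack_sort w) = length w"
  using assms by (metis mset_stack_sort mset_eq_length)

text \<open>Stack sorting only compares letters. This is used for the relabelling in
  \<open>insert_right\<close> and for normalization.\<close>

lemma stack_sort_map:
  fixes f :: "'a::linorder \<Rightarrow> 'b::linorder"
  assumes "distinct w" and "strict_mono_on (set w) f"
  shows "stack_sort (map f w) = map f (stack_sort w)"
  using assms
proof (induction rule: distinct_max_induct)
  case (max L m R)
  then have *: "strict_mono_on (set L) f" "strict_mono_on (set R) f"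
    by (auto simp: strict_mono_on_def)
  moreover have "\<forall>x\<in>set (map f L) \<union> set (map f R). x < f m"
    using max.hyps(2) max.prems by (auto simp: strict_mono_on_def)
  ultimately show ?case
    using max by (simp add: stack_sort_append_max)
qed simp

section \<open>Sorted lists of finite sets\<close>

lemma sorted_list_of_set_image:
  fixes f :: "'a::linorder \<Rightarrow> 'b::linorder"
  assumes "finite A" "strict_mono_on A f"
  shows "sorted_list_of_set (f ` A) = map f (sorted_list_of_set A)"
proof (rule sorted_distinct_set_unique)
  have "sorted_wrt (\<lambda>x y. x < y \<and> x \<in> A \<and> y \<in> A) (sorted_list_of_set A)"
    using assms(1) by (intro sorted_wrt_mono_rel[OF _ strict_sorted_list_of_set]) auto
  then have "sorted_wrt (<) (map f (sorted_list_of_set A))"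
    unfolding sorted_wrt_map
    by (rule sorted_wrt_mono_rel[rotated]) (use assms in \<open>auto simp: strict_mono_on_def\<close>)
  then show "sorted (map f (sorted_list_of_set A))" "distinct (map f (sorted_list_of_set A))"
    by (auto simp: strict_sorted_iff)
qed (use assms in auto)

lemma sorted_list_of_set_split:
  fixes a :: "'a::linorder"
  assumes "finite A"
  shows "sorted_list_of_set A =
    sorted_list_of_set {v\<in>A. v < a} @ sorted_list_of_set {v\<in>A. \<not> v < a}"
  using assms
  by (intro sorted_distinct_set_unique) (auto simp: sorted_append)

lemma sorted_list_of_set_insert_max:
  fixes m :: "'a::linorder"
  assumes "finite A" "\<forall>x\<in>A. x < m"
  shows "sorted_list_of_set (insert m A) = sorted_list_of_set A @ [m]"
  using assms
  by (intro sorted_distinct_set_unique) (auto simp: sorted_append intro: less_imp_le)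

lemma sorted_list_of_set_insert_min:
  fixes m :: "'a::linorder"
  assumes "finite A" "\<forall>x\<in>A. m < x"
  shows "sorted_list_of_set (insert m A) = m # sorted_list_of_set A"
  using assms
  by (intro sorted_distinct_set_unique) (auto intro: less_imp_le)

lemma sorted_list_of_set_Max:
  fixes A :: "'a::linorder set"
  assumes "finite A" "A \<noteq> {}"
  shows "sorted_list_of_set A = sorted_list_of_set (A - {Max A}) @ [Max A]"
proof -
  have "\<forall>x\<in>A - {Max A}. x < Max A"
    using assms(1) by (metis DiffE Max_ge insertI1 le_neq_trans)
  with assms(1) have "sorted_list_of_set (insert (Max A) (A - {Max A}))
      = sorted_list_of_set (A - {Max A}) @ [Max A]"
    by (intro sorted_list_of_set_insert_max) auto
  then show ?thesis using assms by (simp add: insert_absorb)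
qed

section \<open>Right-to-left maxima\<close>

lemma rl_maxima_Nil [simp]: "rl_maxima [] = {}"
  by (simp add: rl_maxima_def)

lemma rl_maxima_iff:
  "v \<in> rl_maxima w \<longleftrightarrow>
    (\<exists>i<length w. v = w ! i \<and> (\<forall>j<length w. i < j \<longrightarrow> w ! j < w ! i))"
  unfolding rl_maxima_def by blast

lemma rl_maxima_snoc: "rl_maxima (w @ [a]) = insert a {v\<in>rl_maxima w. a < v}"
proof (rule set_eqI)
  fix v
  let ?n = "length w"
  have "v \<in> rl_maxima (w @ [a]) \<longleftrightarrow>
      (\<exists>i<?n. v = w ! i \<and> (\<forall>j<?n. i < j \<longrightarrow> w ! j < w ! i) \<and> a < w ! i) \<or> v = a"
    by (simp add: rl_maxima_iff Ex_less_Suc All_less_Suc nth_append cong: conj_cong) blast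
  then show "v \<in> rl_maxima (w @ [a]) \<longleftrightarrow> v \<in> insert a {v\<in>rl_maxima w. a < v}"
    by (auto simp: rl_maxima_iff)
qed

lemma rl_maxima_append:
  "rl_maxima (u @ w) = {v\<in>rl_maxima u. \<forall>x\<in>set w. x < v} \<union> rl_maxima w"
proof (induction w rule: rev_induct)
  case (snoc a w)
  show ?case
    unfolding append_assoc[symmetric] rl_maxima_snoc snoc.IH by auto
qed simp

lemma rl_maxima_subset: "rl_maxima w \<subseteq> set w"
  by (auto simp: rl_maxima_def)

lemma finite_rl_maxima [simp]: "finite (rl_maxima w)"
  using rl_maxima_subset finite_subset by blast

text \<open>The letter \<open>m\<close> dominates all of \<open>L\<close> and leaves the maxima of
  \<open>R\<close> intact. This lets inductions follow \<open>stack_sort_append_max\<close> in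
  parallel.\<close>

lemma rl_maxima_append_max:
  assumes "\<forall>x\<in>set L \<union> set R. x < m"
  shows "rl_maxima (L @ m # R) = insert m (rl_maxima R)"
proof -
  have "{v\<in>rl_maxima L. m < v} = {}" using assms rl_maxima_subset[of L] by (auto dest: less_asym)
  then show ?thesis
    using assms rl_maxima_append[of "L @ [m]" R] by (auto simp: rl_maxima_snoc)
qed

lemma rl_maxima_map:
  assumes "strict_mono_on (set w) f"
  shows "rl_maxima (map f w) = f ` rl_maxima w"
  using assms
proof (induction w rule: rev_induct)
  case (snoc a w)
  then have "strict_mono_on (set w) f" by (auto simp: strict_mono_on_def)
  then have IH: "rl_maxima (map f w) = f ` rl_maxima w" by (rule snoc.IH)
  have "f a < f v \<longleftrightarrow> a < v" if "v \<in> rl_maxima w" for v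
    using that rl_maxima_subset snoc.prems strict_mono_on_less[of "set (w @ [a])" f a v] by auto
  with IH show ?case by (auto simp: rl_maxima_snoc)
qed simp

section \<open>The output before the stack is emptied\<close>

text \<open>While \<open>w\<close> is being stack sorted, just before the stack is emptied it contains the
  right-to-left maxima of \<open>w\<close>, and \<open>popped w\<close> is what has been output.\<close>

definition popped :: "nat list \<Rightarrow> nat list" where
  "popped w = take (length w - card (rl_maxima w)) (stack_sort w)"

text \<open>For \<open>L @ m # R\<close> the output ends with \<open>stack_sort R @ [m]\<close>, and
  the right-to-left maxima are those of \<open>R\<close> together with the larger \<open>m\<close>,
  so the induction hypothesis for \<open>R\<close> suffices. Comparing lengths identifies the
  remaining prefix as \<open>popped w\<close>.\<close>

lemma stack_sort_popped:
  assumes "distinct w"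
  shows "stack_sort w = popped w @ sorted_list_of_set (rl_maxima w)"
proof -
  have "\<exists>u. stack_sort w = u @ sorted_list_of_set (rl_maxima w)"
    using assms
  proof (induction rule: distinct_max_induct)
    case (max L m R)
    then obtain u where "stack_sort R = u @ sorted_list_of_set (rl_maxima R)" by blast
    moreover have "\<forall>x\<in>rl_maxima R. x < m" using max.hyps(2) rl_maxima_subset by auto
    ultimately show ?case
      using max.hyps
      by (simp add: stack_sort_append_max rl_maxima_append_max sorted_list_of_set_insert_max)
  qed simp
  then obtain u where u: "stack_sort w = u @ sorted_list_of_set (rl_maxima w)" by blast
  have "length w = length u + card (rl_maxima w)"
    using arg_cong[OF u, of length] assms by (simp add: length_stack_sort)
  then have "popped w = u" by (simp add: popped_def u)
  with u show ?thesis by simp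
qed

text \<open>In terms of the stack: reading \<open>a\<close> pops the letters below it, and
  \<open>a\<close> then rests on the larger ones until the stack is emptied. In the induction,
  \<open>a\<close> is either a new overall maximum or a letter appended to \<open>R\<close>.\<close>

lemma stack_sort_snoc:
  assumes "distinct w" "a \<notin> set w"
  shows "stack_sort (w @ [a]) = popped w @ sorted_list_of_set {v\<in>rl_maxima w. v < a}
    @ a # sorted_list_of_set {v\<in>rl_maxima w. a < v}"
  using assms
proof (induction rule: distinct_max_induct)
  case Nil
  then show ?case using stack_sort_append_max[of "[]" "[]" a] by (simp add: popped_def)
next
  case (max L m R)
  let ?w = "L @ m # R"
  have R: "\<forall>x\<in>rl_maxima R. x < m" using max.hyps(2) rl_maxima_subset by auto
  show ?case
  proof (cases "m < a")
    case True
    have less: "\<forall>x\<in>set ?w. x < a" using True max.hyps(2) by (auto intro: less_trans)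
    then have "stack_sort (?w @ [a]) = stack_sort ?w @ [a]"
      using stack_sort_append_max[of ?w "[]" a] by simp
    moreover have "{v\<in>rl_maxima ?w. v < a} = rl_maxima ?w" "{v\<in>rl_maxima ?w. a < v} = {}"
      using less rl_maxima_subset[of ?w] by (blast dest: less_asym)+
    ultimately show ?thesis using stack_sort_popped[OF max.hyps(1)] by (simp only:) simp
  next
    case False
    then have am: "a < m" using max.prems by auto
    \<comment> \<open>Both sides of this chain end with the sorted maxima of \<open>?w\<close>;
      cancelling them computes \<open>popped ?w\<close>.\<close>
    have "popped ?w @ sorted_list_of_set (rl_maxima ?w) = stack_sort L @ stack_sort R @ [m]"
      using max.hyps by (simp add: stack_sort_popped[symmetric, of ?w] stack_sort_append_max)
    also have "\<dots> = (stack_sort L @ popped R) @ sorted_list_of_set (rl_maxima ?w)"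
      using max.hyps R
      by (simp add: rl_maxima_append_max sorted_list_of_set_insert_max stack_sort_popped[of R])
    finally have p: "popped ?w = stack_sort L @ popped R" by (simp only: append_same_eq)
    have "stack_sort (?w @ [a]) = stack_sort L @ stack_sort (R @ [a]) @ [m]"
      using stack_sort_append_max[of L "R @ [a]" m] am max.hyps(2) by auto
    moreover have "{v\<in>rl_maxima ?w. v < a} = {v\<in>rl_maxima R. v < a}"
      "{v\<in>rl_maxima ?w. a < v} = insert m {v\<in>rl_maxima R. a < v}"
      using am max.hyps(2) by (auto simp: rl_maxima_append_max)
    ultimately show ?thesis
      using max.IH(2) max.prems R by (simp add: p sorted_list_of_set_insert_max)
  qed
qed

lemma popped_snoc:
  assumes "distinct w" "a \<notin> set w"
  shows "popped (w @ [a]) = popped w @ sorted_list_of_set {v\<in>rl_maxima w. v < a}"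
proof -
  have "sorted_list_of_set (rl_maxima (w @ [a])) = a # sorted_list_of_set {v\<in>rl_maxima w. a < v}"
    by (simp add: rl_maxima_snoc sorted_list_of_set_insert_min)
  then show ?thesis
    using stack_sort_snoc[OF assms] stack_sort_popped[of "w @ [a]"] assms by simp
qed

lemma popped_map:
  assumes "distinct w" "strict_mono_on (set w) f"
  shows "popped (map f w) = map f (popped w)"
proof -
  have "inj_on f (rl_maxima w)"
    using strict_mono_on_imp_inj_on[OF assms(2)] rl_maxima_subset inj_on_subset by blast
  then show ?thesis
    by (simp add: popped_def stack_sort_map[OF assms] rl_maxima_map[OF assms(2)] card_image take_map)
qed

section \<open>Pattern avoidance and the sorting criterion\<close>

primrec avoids :: "('a \<Rightarrow> 'a \<Rightarrow> 'a \<Rightarrow> bool) \<Rightarrow> 'a list \<Rightarrow> bool" where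
  "avoids P [] = True"
| "avoids P (x # w) = (sorted_wrt (\<lambda>y z. \<not> P x y z) w \<and> avoids P w)"

text \<open>An occurrence lies within \<open>u\<close>, within \<open>v\<close>, or has two letters
  in one of them and one in the other. Here \<open>sorted_wrt\<close> acts as a quantifier over
  ordered pairs of positions.\<close>

lemma avoids_append:
  "avoids P (u @ v) \<longleftrightarrow> avoids P u \<and> avoids P v
    \<and> (\<forall>z\<in>set v. sorted_wrt (\<lambda>x y. \<not> P x y z) u)
    \<and> (\<forall>x\<in>set u. sorted_wrt (\<lambda>y z. \<not> P x y z) v)"
  by (induction u) (auto simp: sorted_wrt_append)

lemma avoids_map: "avoids P (map f w) \<longleftrightarrow> avoids (\<lambda>x y z. P (f x) (f y) (f z)) w"
  by (induction w) (auto simp: sorted_wrt_map)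

lemma avoids_cong:
  assumes "\<And>x y z. x \<in> set w \<Longrightarrow> y \<in> set w \<Longrightarrow> z \<in> set w \<Longrightarrow> P x y z \<longleftrightarrow> Q x y z"
  shows "avoids P w \<longleftrightarrow> avoids Q w"
  using assms
proof (induction w)
  case (Cons a w)
  have "sorted_wrt (\<lambda>y z. \<not> P a y z) w \<longleftrightarrow> sorted_wrt (\<lambda>y z. \<not> Q a y z) w"
    using Cons.prems by (auto elim!: sorted_wrt_mono_rel[rotated])
  then show ?case using Cons by auto
qed simp

lemma avoids_rev: "avoids P (rev w) \<longleftrightarrow> avoids (\<lambda>x y z. P z y x) w"
  by (induction w) (auto simp: avoids_append sorted_wrt_rev)

text \<open>The pattern 132 if \<open>s\<close> holds, and 231 otherwise.\<close>

definition pat :: "bool \<Rightarrow> 'a::linorder \<Rightarrow> 'a \<Rightarrow> 'a \<Rightarrow> bool" where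
  "pat s x y z \<longleftrightarrow> x < y \<and> z < y \<and> x \<noteq> z \<and> (x < z \<longleftrightarrow> s)"

lemma avoids_pat_map:
  assumes "strict_mono_on (set w) f"
  shows "avoids (pat s) (map f w) \<longleftrightarrow> avoids (pat s) w"
  unfolding avoids_map
proof (rule avoids_cong)
  fix x y z assume "x \<in> set w" "y \<in> set w" "z \<in> set w"
  then show "pat s (f x) (f y) (f z) \<longleftrightarrow> pat s x y z"
    using assms by (simp add: pat_def strict_mono_on_less strict_mono_on_eq)
qed

text \<open>Knuth's criterion: one pass sorts exactly the words avoiding 231. With the maximum
  \<open>m\<close> as the letter 3, avoidance forces the letters of \<open>L\<close> below those of
  \<open>R\<close>; once this holds, every occurrence lies within \<open>L\<close> or within
  \<open>R\<close>.\<close>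

lemma sorted_stack_sort_iff:
  assumes "distinct w"
  shows "sorted (stack_sort w) \<longleftrightarrow> avoids (pat False) w"
  using assms
proof (induction rule: distinct_max_induct)
  case (max L m R)
  have d: "distinct L" "distinct R" "set L \<inter> set R = {}" using max.hyps by auto
  have "sorted (stack_sort (L @ m # R)) \<longleftrightarrow>
      avoids (pat False) L \<and> avoids (pat False) R \<and> (\<forall>x\<in>set L. \<forall>y\<in>set R. x \<le> y)"
    using max d by (auto simp: stack_sort_append_max sorted_append intro: less_imp_le)
  also have "\<dots> \<longleftrightarrow> avoids (pat False) (L @ m # R)"
  proof -
    have "sorted_wrt (\<lambda>x y. \<not> pat False x y z) L" if "z = m \<or> z \<in> set R \<and> (\<forall>x\<in>set L. x \<le> z)" for z
      by (rule sorted_wrt_if_all) (use that max.hyps in \<open>auto simp: pat_def\<close>)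
    moreover have "sorted_wrt (\<lambda>y z. \<not> pat False x y z) R" if "\<forall>y\<in>set R. x \<le> y" for x
      by (rule sorted_wrt_if_all) (use that in \<open>auto simp: pat_def\<close>)
    moreover have "sorted_wrt (\<lambda>y z. \<not> pat False m y z) R"
      by (rule sorted_wrt_if_all) (use max.hyps(2) in \<open>auto simp: pat_def dest: less_asym\<close>)
    moreover have "x \<le> y" if "x \<in> set L" "y \<in> set R" "\<not> pat False x m y" for x y
      using that max.hyps(2) by (force simp: pat_def)
    moreover have "\<not> pat False x m y" if "x \<le> y" for x y
      using that by (auto simp: pat_def)
    ultimately show ?thesis by (auto simp: avoids_append)
  qed
  finally show ?case .
qed simp

section \<open>The two classes as pattern classes\<close>

lemma is_perm_iff: "is_perm \<sigma> \<longleftrightarrow> distinct \<sigma> \<and> set \<sigma> = {1..length \<sigma>}"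
  by (auto simp: is_perm_def permutations_of_set_def)

lemma id_perm_iff_sorted:
  assumes "mset w = mset \<sigma>" "is_perm \<sigma>"
  shows "w = id_perm (length \<sigma>) \<longleftrightarrow> sorted w"
proof
  assume "sorted w"
  moreover have "distinct w" "set w = {1..length \<sigma>}"
    using assms mset_eq_imp_distinct_iff[of w \<sigma>] mset_eq_setD[of w \<sigma>]
    by (simp_all add: is_perm_iff)
  ultimately show "w = id_perm (length \<sigma>)"
    by (intro sorted_distinct_set_unique) (simp_all add: id_perm_def atLeastLessThanSuc_atLeastAtMost del: upt_Suc)
next
  show "sorted w" if "w = id_perm (length \<sigma>)"
    unfolding that id_perm_def by (rule sorted_upt)
qed

definition pattern_class :: "bool \<Rightarrow> nat list set" where
  "pattern_class s = {\<sigma>. is_perm \<sigma> \<and> avoids (pat s) (stack_sort \<sigma>)}"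

text \<open>The sorting criterion is applied to the word \<open>stack_sort \<sigma>\<close>.\<close>

lemma class_SS_eq: "class_SS = pattern_class False"
proof -
  have "stack_sort (stack_sort \<sigma>) = id_perm (length \<sigma>) \<longleftrightarrow> avoids (pat False) (stack_sort \<sigma>)"
    if "is_perm \<sigma>" for \<sigma>
  proof -
    have "distinct \<sigma>" using that by (simp add: is_perm_iff)
    then show ?thesis
      using that by (simp add: id_perm_iff_sorted distinct_stack_sort sorted_stack_sort_iff)
  qed
  then show ?thesis unfolding class_SS_def pattern_class_def by (intro Collect_cong conj_cong refl)
qed

text \<open>As for \<open>class_SS\<close>, except that the reversal turns the forbidden 231 into
  132.\<close>

lemma class_SrS_eq: "class_SrS = pattern_class True"
proof -
  have pat: "(\<lambda>x y z. pat False z y x) = pat True"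
    by (auto simp: pat_def fun_eq_iff)
  have "stack_sort (rev (stack_sort \<sigma>)) = id_perm (length \<sigma>) \<longleftrightarrow> avoids (pat True) (stack_sort \<sigma>)"
    if "is_perm \<sigma>" for \<sigma>
  proof -
    have "distinct \<sigma>" using that by (simp add: is_perm_iff)
    then show ?thesis
      using that
      by (simp add: id_perm_iff_sorted distinct_stack_sort sorted_stack_sort_iff avoids_rev pat)
  qed
  then show ?thesis unfolding class_SrS_def pattern_class_def by (intro Collect_cong conj_cong refl)
qed


section \<open>Insertion of a last letter\<close>

text \<open>Relative to the site \<open>t\<close>, the letters \<open>x\<close> and \<open>y\<close> form \<open>pat s\<close> with a later letter
  inserted at \<open>t\<close>.\<close>

definition site_pat :: "bool \<Rightarrow> nat \<Rightarrow> nat \<Rightarrow> nat \<Rightarrow> bool" where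
  "site_pat s t x y \<longleftrightarrow> x < y \<and> t < y \<and> (x \<le> t \<longleftrightarrow> s)"

definition shift :: "nat \<Rightarrow> nat \<Rightarrow> nat" where
  "shift t v = (if v \<ge> t + 1 then v + 1 else v)"

lemma insert_right_eq: "insert_right \<pi> t = map (shift t) \<pi> @ [t + 1]"
  by (simp add: insert_right_def shift_def fun_eq_iff)

lemma strict_mono_shift: "strict_mono_on A (shift t)"
  by (auto simp: strict_mono_on_def shift_def)

lemma inj_shift: "inj_on (shift t) A"
  using strict_mono_shift strict_mono_on_imp_inj_on by blast

lemma shift_neq [simp]: "shift t v \<noteq> Suc t" "Suc t \<noteq> shift t v"
  by (auto simp: shift_def)

lemma shift_less_iff: "shift t v < Suc t \<longleftrightarrow> v \<le> t" "Suc t < shift t v \<longleftrightarrow> t < v"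
  by (auto simp: shift_def)

lemma pat_shift: "pat s (shift t x) (shift t y) (Suc t) \<longleftrightarrow> site_pat s t x y"
  by (auto simp: pat_def site_pat_def shift_def)

text \<open>The sites \<open>t\<close> and \<open>t + 1\<close> of the child both correspond to the
  site \<open>t\<close> of the parent; this is how the chosen site is split in two.\<close>

lemma site_pat_shift:
  "site_pat s u (shift t x) (shift t y) \<longleftrightarrow> site_pat s (if u \<le> t then u else u - 1) x y"
  by (auto simp: site_pat_def shift_def)

lemma is_perm_insert_right:
  assumes "is_perm \<pi>" "t \<le> length \<pi>"
  shows "is_perm (insert_right \<pi> t)"
proof -
  have d: "distinct (insert_right \<pi> t)"
    using assms by (auto simp: is_perm_iff insert_right_eq distinct_map inj_shift)
  moreover have "set (insert_right \<pi> t) \<subseteq> {1..length \<pi> + 1}"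
    using assms by (auto simp: is_perm_iff insert_right_eq shift_def)
  moreover have "card (set (insert_right \<pi> t)) = length \<pi> + 1"
    using distinct_card[OF d] by (simp add: insert_right_eq)
  ultimately have "set (insert_right \<pi> t) = {1..length \<pi> + 1}"
    by (intro card_subset_eq) auto
  with d show ?thesis by (simp add: is_perm_iff insert_right_eq)
qed

text \<open>The letter \<open>a\<close> cannot come first in an occurrence, since \<open>hi\<close>
  is sorted, nor second, since no smaller letter follows it. If it is the third, the second letter
  exceeds \<open>a\<close>, hence lies in \<open>u\<close>, and so does the first.\<close>

lemma avoids_pat_insert:
  assumes "\<forall>x\<in>set lo. x < a" "\<forall>x\<in>set hi. a < x" "sorted hi"
  shows "avoids (pat s) (u @ lo @ a # hi) \<longleftrightarrow>
    avoids (pat s) (u @ lo @ hi) \<and> sorted_wrt (\<lambda>x y. \<not> pat s x y a) u"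
proof -
  have 1: "sorted_wrt (\<lambda>y z. \<not> pat s a y z) hi"
    using assms(3) by (rule sorted_wrt_mono_rel[rotated]) (auto simp: pat_def)
  have 2: "sorted_wrt (\<lambda>x y. \<not> pat s x y a) lo"
    by (rule sorted_wrt_if_all) (use assms(1) in \<open>auto simp: pat_def dest: less_asym\<close>)
  have 3: "\<forall>x\<in>set u. \<forall>y\<in>set lo. \<not> pat s x y a"
    using assms(1) by (auto simp: pat_def dest: less_asym)
  have 4: "\<forall>z\<in>set hi. \<not> pat s x a z" for x
    using assms(2) by (auto simp: pat_def dest: less_asym)
  have "avoids (pat s) (p @ a # hi) \<longleftrightarrow>
      avoids (pat s) (p @ hi) \<and> sorted_wrt (\<lambda>x y. \<not> pat s x y a) p" for p
    using 1 4 by (simp add: avoids_append) blast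
  from this[of "u @ lo"] show ?thesis
    using 2 3 by (simp add: sorted_wrt_append)
qed

lemma avoids_pat_stack_sort_snoc:
  assumes "distinct w" "a \<notin> set w"
  shows "avoids (pat s) (stack_sort (w @ [a])) \<longleftrightarrow>
    avoids (pat s) (stack_sort w) \<and> sorted_wrt (\<lambda>x y. \<not> pat s x y a) (popped w)"
proof -
  have hi: "{v\<in>rl_maxima w. a < v} = {v\<in>rl_maxima w. \<not> v < a}"
    using assms(2) rl_maxima_subset[of w] by (auto simp: not_less le_less)
  have "stack_sort w = popped w @ sorted_list_of_set {v\<in>rl_maxima w. v < a}
      @ sorted_list_of_set {v\<in>rl_maxima w. a < v}"
    unfolding hi
    using stack_sort_popped[OF assms(1)] sorted_list_of_set_split[of "rl_maxima w" a] by simp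
  then show ?thesis
    by (simp add: stack_sort_snoc[OF assms] avoids_pat_insert)
qed

text \<open>The old letters keep their relative order and avoid the pattern already, so only
  occurrences ending in the new letter can make a site inactive.\<close>

lemma active_sites_pattern_class:
  assumes "\<pi> \<in> pattern_class s"
  shows "active_sites (pattern_class s) \<pi> =
    {t \<in> {0..length \<pi>}. sorted_wrt (\<lambda>x y. \<not> site_pat s t x y) (popped \<pi>)}"
proof -
  have \<pi>: "is_perm \<pi>" "distinct \<pi>" "avoids (pat s) (stack_sort \<pi>)"
    using assms by (auto simp: pattern_class_def is_perm_iff)
  have "insert_right \<pi> t \<in> pattern_class s \<longleftrightarrow>
      sorted_wrt (\<lambda>x y. \<not> site_pat s t x y) (popped \<pi>)" if "t \<le> length \<pi>" for t
  proof -
    have "insert_right \<pi> t \<in> pattern_class s \<longleftrightarrow>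
        avoids (pat s) (stack_sort (map (shift t) \<pi> @ [t + 1]))"
      using is_perm_insert_right[OF \<pi>(1) that] by (simp add: pattern_class_def insert_right_eq)
    also have "\<dots> \<longleftrightarrow> sorted_wrt (\<lambda>x y. \<not> pat s x y (t + 1)) (popped (map (shift t) \<pi>))"
      using \<pi> by (subst avoids_pat_stack_sort_snoc)
        (auto simp: distinct_map inj_shift stack_sort_map strict_mono_shift avoids_pat_map)
    also have "\<dots> \<longleftrightarrow> sorted_wrt (\<lambda>x y. \<not> site_pat s t x y) (popped \<pi>)"
      using \<pi> by (simp add: popped_map strict_mono_shift sorted_wrt_map pat_shift)
    finally show ?thesis .
  qed
  then show ?thesis by (auto simp: active_sites_def)
qed

section \<open>Active sites of a child\<close>

lemma rl_maxima_insert_right: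
  "rl_maxima (insert_right \<pi> t) = insert (t + 1) (Suc ` {v\<in>rl_maxima \<pi>. t < v})"
  by (auto simp: insert_right_eq rl_maxima_snoc rl_maxima_map strict_mono_shift shift_def)

lemma popped_insert_right:
  assumes "distinct \<pi>"
  shows "popped (insert_right \<pi> t) =
    map (shift t) (popped \<pi> @ sorted_list_of_set {v\<in>rl_maxima \<pi>. v \<le> t})"
proof -
  have "{v \<in> rl_maxima (map (shift t) \<pi>). v < t + 1} = shift t ` {v\<in>rl_maxima \<pi>. v \<le> t}"
    by (auto simp: rl_maxima_map strict_mono_shift shift_less_iff)
  moreover have "distinct (map (shift t) \<pi>)" "t + 1 \<notin> set (map (shift t) \<pi>)"
    using assms by (auto simp: distinct_map inj_shift)
  ultimately show ?thesis
    using assms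
    by (simp add: insert_right_eq popped_snoc popped_map strict_mono_shift sorted_list_of_set_image)
qed

text \<open>The activity condition of the child, expressed by sites and values of the parent: the
  word is \<open>popped (insert_right \<pi> t)\<close> before relabelling.\<close>

definition inherited_sites :: "bool \<Rightarrow> nat list \<Rightarrow> nat \<Rightarrow> nat set" where
  "inherited_sites s \<pi> t = {u \<in> {0..length \<pi>}. sorted_wrt (\<lambda>x y. \<not> site_pat s u x y)
     (popped \<pi> @ sorted_list_of_set {v\<in>rl_maxima \<pi>. v \<le> t})}"

lemma active_sites_insert_right:
  assumes "\<pi> \<in> pattern_class s" "t \<in> active_sites (pattern_class s) \<pi>"
  shows "active_sites (pattern_class s) (insert_right \<pi> t) =
    {u\<in>inherited_sites s \<pi> t. u \<le> t} \<union> Suc ` {u\<in>inherited_sites s \<pi> t. t \<le> u}"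
proof -
  have d: "distinct \<pi>" using assms(1) by (simp add: pattern_class_def is_perm_iff)
  have t: "t \<le> length \<pi>" "insert_right \<pi> t \<in> pattern_class s"
    using assms(2) by (auto simp: active_sites_def)
  have len: "length (insert_right \<pi> t) = length \<pi> + 1" by (simp add: insert_right_eq)
  have B: "inherited_sites s \<pi> t \<subseteq> {..length \<pi>}" by (auto simp: inherited_sites_def)
  have iff: "u \<in> active_sites (pattern_class s) (insert_right \<pi> t) \<longleftrightarrow>
      u \<le> length \<pi> + 1 \<and> (if u \<le> t then u else u - 1) \<in> inherited_sites s \<pi> t" for u
    unfolding active_sites_pattern_class[OF t(2)] popped_insert_right[OF d] len
      inherited_sites_def sorted_wrt_map site_pat_shift
    using t(1) by auto
  show ?thesis
  proof (rule set_eqI)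
    fix u
    show "u \<in> active_sites (pattern_class s) (insert_right \<pi> t) \<longleftrightarrow>
      u \<in> {u\<in>inherited_sites s \<pi> t. u \<le> t} \<union> Suc ` {u\<in>inherited_sites s \<pi> t. t \<le> u}"
    proof (cases "u \<le> t")
      case True
      then show ?thesis using iff[of u] t(1) by auto
    next
      case False
      then obtain w where "u = Suc w" "t \<le> w" by (cases u) auto
      then show ?thesis using iff[of u] B by auto
    qed
  qed
qed

lemma inherited_sites_no_rl_maxima:
  assumes "\<pi> \<in> pattern_class s" "{v\<in>rl_maxima \<pi>. v \<le> t} = {}"
  shows "inherited_sites s \<pi> t = active_sites (pattern_class s) \<pi>"
  unfolding inherited_sites_def active_sites_pattern_class[OF assms(1)] assms(2) by simp

text \<open>The largest maximum \<open>v\<close> moved into the popped part is the last letter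
  there. Sites from \<open>v\<close> on are unaffected, because an obstructing pair needs its second
  letter above the site. Below \<open>v\<close>, pairs ending in \<open>v\<close> block all sites
  but one.\<close>

lemma inherited_sites_rl_maxima:
  assumes "\<pi> \<in> pattern_class s" "V = {v\<in>rl_maxima \<pi>. v \<le> t}" "V \<noteq> {}"
  shows "inherited_sites s \<pi> t = insert (if s then 0 else Max V - 1)
    {u\<in>active_sites (pattern_class s) \<pi>. Max V \<le> u}" (is "_ = insert ?e _")
proof -
  define v where "v = Max V"
  define q where "q = popped \<pi> @ sorted_list_of_set (V - {v})"
  have \<pi>: "distinct \<pi>" "set \<pi> = {1..length \<pi>}" "avoids (pat s) (stack_sort \<pi>)"
    using assms(1) by (auto simp: pattern_class_def is_perm_iff)
  have fin: "finite V" by (simp add: assms(2))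
  then have v: "v \<in> V" "\<And>x. x \<in> V \<Longrightarrow> x \<le> v" using assms(3) by (auto simp: v_def)
  then have vR: "v \<in> rl_maxima \<pi>" "v \<le> t" using assms(2) by auto
  then have vn: "1 \<le> v" "v \<le> length \<pi>" using \<pi>(2) rl_maxima_subset[of \<pi>] by auto
  have qv: "popped \<pi> @ sorted_list_of_set V = q @ [v]"
    using sorted_list_of_set_Max[OF fin assms(3)] by (simp add: q_def v_def)
  have "{x\<in>rl_maxima \<pi>. x < Suc t} = V"
    using assms(2) by auto
  then have S: "stack_sort \<pi> = (q @ [v]) @ sorted_list_of_set {x\<in>rl_maxima \<pi>. \<not> x < Suc t}"
    using stack_sort_popped[OF \<pi>(1)] sorted_list_of_set_split[of "rl_maxima \<pi>" "Suc t"] qv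
    by simp
  have dq: "v \<notin> set q" using S distinct_stack_sort[OF \<pi>(1)] by auto
  have av: "sorted_wrt (\<lambda>x y. \<not> pat s x y v) q" using S \<pi>(3) by (auto simp: avoids_append)
  \<comment> \<open>The letters of \<open>stack_sort \<pi>\<close> after \<open>v\<close> exceed
    \<open>t\<close>, so all values below \<open>v\<close> occur in \<open>q\<close>.\<close>
  have "set (stack_sort \<pi>) = {1..length \<pi>}" using \<pi> by simp
  then have sq: "set q \<subseteq> {1..}" "{1..<v} \<subseteq> set q"
    unfolding S using vn \<open>v \<le> t\<close> by auto
  have above: "sorted_wrt (\<lambda>x y. \<not> site_pat s u x y) (q @ [v]) \<longleftrightarrow>
      sorted_wrt (\<lambda>x y. \<not> site_pat s u x y) (popped \<pi>)" if "v \<le> u" for u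
  proof -
    have *: "\<not> site_pat s u x y" if "y \<in> V" for x y
      using v(2)[OF that] \<open>v \<le> u\<close> by (simp add: site_pat_def)
    then have "sorted_wrt (\<lambda>x y. \<not> site_pat s u x y) (sorted_list_of_set V)"
      using fin by (intro sorted_wrt_if_all) auto
    with * show ?thesis
      unfolding qv[symmetric] using fin by (auto simp: sorted_wrt_append)
  qed
  have below: "sorted_wrt (\<lambda>x y. \<not> site_pat s u x y) (q @ [v]) \<longleftrightarrow> u = ?e" if "u < v" for u
  proof
    assume "sorted_wrt (\<lambda>x y. \<not> site_pat s u x y) (q @ [v])"
    then have *: "\<not> site_pat s u x v" if "x \<in> set q" for x
      using that by (simp add: sorted_wrt_append)
    show "u = ?e"
    \<comment> \<open>For 132 the value \<open>u\<close> followed by \<open>v\<close> blocks the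
      site \<open>u\<close>, unless \<open>u = 0\<close> is not a letter. For 231 the value
      \<open>u + 1\<close> followed by \<open>v\<close> does, unless it is \<open>v\<close>
      itself.\<close>
    proof (cases s)
      case True
      then show ?thesis
        using *[of u] subsetD[OF sq(2), of u] \<open>u < v\<close> by (cases u) (auto simp: site_pat_def)
    next
      case False
      then show ?thesis
        using *[of "u + 1"] subsetD[OF sq(2), of "u + 1"] \<open>u < v\<close>
        by (cases "u + 1 = v") (auto simp: site_pat_def v_def[symmetric])
    qed
  next
    assume u: "u = ?e"
    have "\<not> site_pat s u x v" if "x \<in> set q" for x
      using that sq(1) u by (auto simp: site_pat_def v_def[symmetric])
    moreover have "sorted_wrt (\<lambda>x y. \<not> site_pat s u x y) q"
    proof -
      \<comment> \<open>A pair of \<open>q\<close> blocking the exceptional site would need a letter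
        \<open>0\<close> for 132, and would form 231 with \<open>v\<close> otherwise. Membership in
        \<open>q\<close> is carried along to exclude the letters \<open>0\<close> and
        \<open>v\<close>.\<close>
      have "sorted_wrt (\<lambda>x y. \<not> pat s x y v \<and> x \<in> set q \<and> y \<in> set q) q"
        using av by (auto simp: sorted_wrt_iff_nth_less)
      then show ?thesis
      proof (rule sorted_wrt_mono_rel[rotated])
        fix x y assume "\<not> pat s x y v \<and> x \<in> set q \<and> y \<in> set q"
        moreover from this have "x \<noteq> v" "y \<noteq> v" "x \<ge> 1" using dq sq(1) by auto
        ultimately show "\<not> site_pat s u x y"
          using u vn(1) by (auto simp: site_pat_def pat_def v_def[symmetric])
      qed
    qed
    ultimately show "sorted_wrt (\<lambda>x y. \<not> site_pat s u x y) (q @ [v])"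
      by (simp add: sorted_wrt_append)
  qed
  have e: "?e < v" using vn(1) by (simp add: v_def[symmetric])
  have "u \<in> inherited_sites s \<pi> t \<longleftrightarrow>
      u = ?e \<or> u \<in> active_sites (pattern_class s) \<pi> \<and> v \<le> u" for u
    using above[of u] below[of u] e vn(2)
    unfolding inherited_sites_def assms(2)[symmetric] qv active_sites_pattern_class[OF assms(1)]
    by (cases "u < v") auto
  then show ?thesis by (auto simp: v_def[symmetric])
qed

section \<open>Ranks of active sites\<close>

definition sites_from :: "nat set \<Rightarrow> nat \<Rightarrow> nat" where
  "sites_from A v = card {u\<in>A. v \<le> u}"

lemma sites_from_less_iff:
  assumes "finite A" "t \<in> A"
  shows "sites_from A v < sites_from A t \<longleftrightarrow> t < v"
proof
  assume "t < v"
  then have "t \<in> {u\<in>A. t \<le> u} - {u\<in>A. v \<le> u}" "{u\<in>A. v \<le> u} \<subseteq> {u\<in>A. t \<le> u}"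
    using assms(2) by auto
  then have "{u\<in>A. v \<le> u} \<subset> {u\<in>A. t \<le> u}" by blast
  then show "sites_from A v < sites_from A t"
    unfolding sites_from_def using assms(1) by (intro psubset_card_mono) auto
next
  assume less: "sites_from A v < sites_from A t"
  show "t < v"
  proof (rule ccontr)
    assume "\<not> t < v"
    then have "sites_from A t \<le> sites_from A v"
      unfolding sites_from_def using assms(1) by (intro card_mono) auto
    with less show False by simp
  qed
qed

lemma sites_from_antimono: "finite A \<Longrightarrow> u \<le> v \<Longrightarrow> sites_from A v \<le> sites_from A u"
  unfolding sites_from_def by (intro card_mono) auto

lemma sites_from_le: "finite A \<Longrightarrow> sites_from A v \<le> card A"
  unfolding sites_from_def by (intro card_mono) auto

text \<open>On active sites, \<open>sites_from A\<close> is the rank counted from the top. This rank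
  becomes the last entry \<open>i\<close> in the label of the child.\<close>

lemma bij_betw_sites_from:
  assumes "finite A"
  shows "bij_betw (sites_from A) A {1..card A}"
proof -
  have inj: "inj_on (sites_from A) A"
    using sites_from_less_iff[OF assms] by (metis inj_onI less_irrefl nat_neq_iff)
  have "sites_from A t \<in> {1..card A}" if "t \<in> A" for t
  proof -
    have "t \<in> {u\<in>A. t \<le> u}" using that by simp
    then have "sites_from A t \<noteq> 0" unfolding sites_from_def using assms by auto
    then show ?thesis using sites_from_le[OF assms, of t] by simp
  qed
  then have "sites_from A ` A = {1..card A}"
    using card_image[OF inj] by (intro card_subset_eq) auto
  with inj show ?thesis by (simp add: bij_betw_def)
qed

text \<open>The first component is determined by the second: it is the index of the interval of the
  partition \<open>q\<close> that contains \<open>sites_from A t\<close>.\<close>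

lemma bij_betw_sites_intervals:
  fixes r :: "nat list"
  assumes fin: "finite A" and r: "sorted_wrt (>) r"
    and q: "q = 0 # map (sites_from A) r @ [card A]"
  shows "bij_betw (\<lambda>t. (length (filter ((<) t) r) + 1, sites_from A t)) A
    (SIGMA j:{1..length r + 1}. {q ! (j - 1)<..q ! j})"
proof -
  define m where "m t = length (filter ((<) t) r)" for t
  have bij: "bij_betw (sites_from A) A {1..card A}" by (rule bij_betw_sites_from[OF fin])
  have "sorted (map (sites_from A) r)"
    unfolding sorted_map
    using r by (rule sorted_wrt_mono_rel[rotated]) (auto intro: sites_from_antimono[OF fin])
  then have sq: "sorted q"
    by (auto simp: q sorted_append sites_from_le[OF fin])
  \<comment> \<open>As \<open>r\<close> is decreasing, the entries above \<open>t\<close> form a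
    prefix of it, of length \<open>m t\<close>.\<close>
  have split: "r = filter ((<) t) r @ filter (\<lambda>v. \<not> t < v) r" for t
    using r
  proof (induction r)
    case (Cons a r)
    then have "filter ((<) t) r = []" if "\<not> t < a" using that by (auto simp: filter_empty_conv)
    then show ?case using Cons by (cases "t < a") auto
  qed simp
  have q_pos: "q ! Suc l = sites_from A (r ! l)" if "l < length r" for l
    using that by (simp add: q nth_append)
  have mem: "q ! m t < sites_from A t" "sites_from A t \<le> q ! Suc (m t)" "m t \<le> length r"
    if "t \<in> A" for t
  proof -
    show le: "m t \<le> length r" by (simp add: m_def)
    show "q ! m t < sites_from A t"
    proof (cases "m t")
      case 0
      then show ?thesis using bij_betw_apply[OF bij that] by (simp add: q)
    next
      case (Suc l)
      then have "r ! l = filter ((<) t) r ! l"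
        by (subst split[of t]) (simp add: nth_append m_def)
      moreover have "filter ((<) t) r ! l \<in> set (filter ((<) t) r)"
        using Suc unfolding m_def by (intro nth_mem) simp
      ultimately have "t < r ! l" by simp
      then show ?thesis using Suc le q_pos[of l] sites_from_less_iff[OF fin that] by simp
    qed
    show "sites_from A t \<le> q ! Suc (m t)"
    proof (cases "m t < length r")
      case True
      have "r ! m t = filter (\<lambda>v. \<not> t < v) r ! 0"
        by (subst split[of t]) (simp add: nth_append m_def)
      moreover have "0 < length (filter (\<lambda>v. \<not> t < v) r)"
        using True arg_cong[OF split[of t], of length] by (simp add: m_def)
      then have "filter (\<lambda>v. \<not> t < v) r ! 0 \<in> set (filter (\<lambda>v. \<not> t < v) r)"
        by (rule nth_mem)
      ultimately have "r ! m t \<le> t" by simp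
      then show ?thesis using q_pos[OF True] sites_from_antimono[OF fin] by simp
    next
      case False
      then have "q ! Suc (m t) = card A" using le by (simp add: q nth_append)
      then show ?thesis using sites_from_le[OF fin] by simp
    qed
  qed
  have "(\<lambda>t. (m t + 1, sites_from A t)) ` A = (SIGMA j:{1..length r + 1}. {q ! (j - 1)<..q ! j})"
  proof (intro equalityI subsetI)
    fix y assume "y \<in> (\<lambda>t. (m t + 1, sites_from A t)) ` A"
    then show "y \<in> (SIGMA j:{1..length r + 1}. {q ! (j - 1)<..q ! j})" using mem by auto
  next
    fix y assume "y \<in> (SIGMA j:{1..length r + 1}. {q ! (j - 1)<..q ! j})"
    then obtain j i where ji: "y = (j, i)" "1 \<le> j" "j \<le> length r + 1" "q ! (j - 1) < i" "i \<le> q ! j"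
      by auto
    then obtain l where "j = Suc l" by (cases j) auto
    with ji have y: "y = (Suc l, i)" "l \<le> length r" "q ! l < i" "i \<le> q ! Suc l" by auto
    have len: "length q = length r + 2" by (simp add: q)
    have "q ! Suc l \<le> q ! (length r + 1)"
      using sq y(2) len by (intro sorted_nth_mono) auto
    also have "\<dots> = card A" by (simp add: q nth_append)
    finally have "i \<in> {1..card A}" using y by simp
    also have "{1..card A} = sites_from A ` A" using bij by (simp only: bij_betw_def)
    finally obtain t where t: "t \<in> A" "i = sites_from A t" by blast
    \<comment> \<open>Since \<open>q\<close> is sorted, its intervals are disjoint, so the rank of
      \<open>t\<close> lies in only one of them.\<close>
    have "m t = l"
    proof (rule linorder_cases)
      assume "m t < l"
      then have "q ! Suc (m t) \<le> q ! l" using sq y(2) len by (intro sorted_nth_mono) auto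
      then show ?thesis using mem(2)[OF t(1)] y(3) t(2) by simp
    next
      assume "l < m t"
      then have "q ! Suc l \<le> q ! m t" using sq mem(3)[OF t(1)] len by (intro sorted_nth_mono) auto
      then show ?thesis using mem(1)[OF t(1)] y(4) t(2) by simp
    qed
    then show "y \<in> (\<lambda>t. (m t + 1, sites_from A t)) ` A" using y(1) t by auto
  qed
  moreover have "inj_on (\<lambda>t. (m t + 1, sites_from A t)) A"
    using bij by (auto simp: bij_betw_def inj_on_def)
  ultimately show ?thesis by (simp add: bij_betw_def m_def)
qed

section \<open>Labels of the children\<close>

lemma finite_active_sites [simp]: "finite (active_sites C \<pi>)"
  by (simp add: active_sites_def)

lemma label_eq:
  "label C \<pi> = (card (active_sites C \<pi>), card (rl_maxima \<pi>),
    map (sites_from (active_sites C \<pi>)) (rev (sorted_list_of_set (rl_maxima \<pi>))))"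
  by (simp add: label_def sites_above_def sites_from_def)

text \<open>The \<open>m\<close> maxima above \<open>t\<close> survive with their counts of sites,
  and \<open>t + 1\<close> joins them. So the index \<open>j\<close> of the rule is
  \<open>m + 1\<close>, and \<open>p ! m\<close> is its \<open>p_j\<close>. If
  \<open>m = length r\<close>, no maximum is removed and all active sites are kept.\<close>

lemma label_insert_right:
  assumes \<pi>: "\<pi> \<in> pattern_class s" and t: "t \<in> active_sites (pattern_class s) \<pi>"
    and A: "A = active_sites (pattern_class s) \<pi>"
    and r: "r = rev (sorted_list_of_set (rl_maxima \<pi>))"
    and p: "p = map (sites_from A) r"
    and m: "m = length (filter ((<) t) r)"
  shows "label (pattern_class s) (insert_right \<pi> t) =
    (if m < length r then 2 + p ! m else card A + 1, m + 1, take m p @ [sites_from A t])"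
proof -
  define B where "B = inherited_sites s \<pi> t"
  define A' where "A' = active_sites (pattern_class s) (insert_right \<pi> t)"
  define V where "V = {v\<in>rl_maxima \<pi>. v \<le> t}"
  define W where "W = {v\<in>rl_maxima \<pi>. t < v}"
  have finA: "finite A" by (simp add: A)
  have finB: "finite B" by (simp add: B_def inherited_sites_def)
  have A': "A' = {u\<in>B. u \<le> t} \<union> Suc ` {u\<in>B. t \<le> u}"
    unfolding A'_def B_def by (rule active_sites_insert_right[OF \<pi> t])
  have W: "{v\<in>rl_maxima \<pi>. \<not> v < Suc t} = W" "{v\<in>rl_maxima \<pi>. v < Suc t} = V"
    by (auto simp: W_def V_def)
  have fin: "finite V" "finite W" by (simp_all add: V_def W_def)
  have rWV: "r = rev (sorted_list_of_set W) @ rev (sorted_list_of_set V)"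
    unfolding r using sorted_list_of_set_split[of "rl_maxima \<pi>" "Suc t"] W by simp
  have "filter ((<) t) (rev (sorted_list_of_set V)) = []"
    using fin(1) by (simp add: filter_empty_conv V_def)
  moreover have "filter ((<) t) (rev (sorted_list_of_set W)) = rev (sorted_list_of_set W)"
    using fin(2) by (simp add: filter_id_conv W_def)
  ultimately have filter_r: "filter ((<) t) r = rev (sorted_list_of_set W)"
    by (simp add: rWV)
  then have mW: "m = card W" by (simp add: m)
  have Max_V: "Max V \<le> t" "1 \<le> Max V" if "V \<noteq> {}"
  proof -
    have "Max V \<in> V" using fin that by simp
    then have "Max V \<in> set \<pi>" "Max V \<le> t" using rl_maxima_subset by (auto simp: V_def)
    moreover have "set \<pi> = {1..length \<pi>}" using \<pi> by (simp add: pattern_class_def is_perm_iff)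
    ultimately show "Max V \<le> t" "1 \<le> Max V" by auto
  qed
  have B: "{u\<in>B. v \<le> u} = {u\<in>A. v \<le> u}" if "t \<le> v" for v
  proof (cases "V = {}")
    case True
    then have "B = A"
      using inherited_sites_no_rl_maxima[OF \<pi>] by (simp add: V_def A B_def)
    then show ?thesis by simp
  next
    case False
    from Max_V[OF this] show ?thesis
      using inherited_sites_rl_maxima[OF \<pi> V_def False] that by (auto simp: A B_def)
  qed
  have cardB: "card B = (if m < length r then 1 + p ! m else card A)"
  proof (cases "V = {}")
    case True
    then have "B = A"
      using inherited_sites_no_rl_maxima[OF \<pi>] by (simp add: V_def A B_def)
    moreover have "length r = m" using True by (simp add: rWV mW)
    ultimately show ?thesis by simp
  next
    case False
    have "sorted_list_of_set V = sorted_list_of_set (V - {Max V}) @ [Max V]"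
      using fin(1) False by (rule sorted_list_of_set_Max)
    then have "m < length r" "r ! m = Max V" by (simp_all add: rWV mW nth_append)
    moreover have "card B = 1 + sites_from A (Max V)"
      unfolding B_def sites_from_def inherited_sites_rl_maxima[OF \<pi> V_def False] A[symmetric]
      using finA Max_V(2)[OF False] by (subst card_insert_disjoint) auto
    ultimately show ?thesis by (simp add: p)
  qed
  \<comment> \<open>The case \<open>v = t\<close> is included: it gives the count for the new
    maximum \<open>t + 1\<close>.\<close>
  have above: "sites_from A' (Suc v) = sites_from A v" if "t \<le> v" for v
  proof -
    have "{u\<in>A'. Suc v \<le> u} = Suc ` {u\<in>B. v \<le> u}"
      using that by (auto simp: A')
    then show ?thesis by (simp add: sites_from_def card_image B[OF that])
  qed
  have tB: "t \<in> B" using B[of t] t by (auto simp: A)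
  \<comment> \<open>The two parts of \<open>B\<close> overlap in \<open>t\<close> alone, which is
    therefore counted twice.\<close>
  have "card A' = card {u\<in>B. u \<le> t} + card {u\<in>B. t \<le> u}"
    unfolding A' using finB by (subst card_Un_disjoint) (auto simp: card_image)
  also have "\<dots> = card ({u\<in>B. u \<le> t} \<union> {u\<in>B. t \<le> u}) + card ({u\<in>B. u \<le> t} \<inter> {u\<in>B. t \<le> u})"
    using finB by (intro card_Un_Int) auto
  also have "{u\<in>B. u \<le> t} \<union> {u\<in>B. t \<le> u} = B" by auto
  also have "{u\<in>B. u \<le> t} \<inter> {u\<in>B. t \<le> u} = {t}" using tB by auto
  finally have cardA': "card A' = card B + 1" by simp
  have rl: "rl_maxima (insert_right \<pi> t) = insert (t + 1) (Suc ` W)"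
    by (simp add: rl_maxima_insert_right W_def)
  have "sorted_list_of_set (insert (t + 1) (Suc ` W)) = (t + 1) # map Suc (sorted_list_of_set W)"
    using fin(2) by (simp add: sorted_list_of_set_insert_min sorted_list_of_set_image
        strict_mono_on_def W_def)
  moreover have "map (sites_from A') (map Suc (rev (sorted_list_of_set W)))
      = map (sites_from A) (rev (sorted_list_of_set W))"
    using fin(2) above by (auto simp: W_def)
  moreover have "take m p = map (sites_from A) (rev (sorted_list_of_set W))"
    by (simp add: p rWV mW)
  moreover have "card (insert (t + 1) (Suc ` W)) = m + 1"
    using fin(2) by (subst card_insert_disjoint) (auto simp: card_image mW W_def)
  ultimately show ?thesis
    using above[of t] cardB cardA'
    by (simp add: label_eq A'_def[symmetric] rl rev_map)
qed

text \<open>Distinct sites give distinct children, so the labels can be summed over sites. Sites are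
  then replaced by pairs \<open>(j, i)\<close>, where \<open>j = k + 1\<close> accounts for the
  second family of labels.\<close>

lemma label_children:
  assumes \<pi>: "\<pi> \<in> pattern_class s" and lab: "label (pattern_class s) \<pi> = (x, k, p)"
  shows "image_mset (label (pattern_class s)) (mset_set (children (pattern_class s) \<pi>))
    = successor_labels x k p"
proof -
  define A where "A = active_sites (pattern_class s) \<pi>"
  define r where "r = rev (sorted_list_of_set (rl_maxima \<pi>))"
  define q where "q = 0 # p @ [x]"
  \<comment> \<open>\<open>F\<close> joins both families into one function of \<open>(j, i)\<close>;
    for \<open>j = k + 1\<close> the \<open>take\<close> returns all of \<open>p\<close>.\<close>
  define F where
    "F = (\<lambda>(j, i). (if j \<le> k then 2 + (0 # p) ! j else x + 1, j, take (j - 1) p @ [i]))"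
  define T where "T t = (length (filter ((<) t) r) + 1, sites_from A t)" for t
  have xkp: "x = card A" "k = length r" "p = map (sites_from A) r"
    using lab by (simp_all add: label_eq A_def r_def)
  have finA: "finite A" by (simp add: A_def)
  have "label (pattern_class s) (insert_right \<pi> t) = F (T t)" if "t \<in> A" for t
    using label_insert_right[OF \<pi> _ A_def r_def xkp(3) refl, of t] that xkp(1,2)
    by (simp add: F_def T_def A_def Suc_le_eq)
  moreover have "inj_on (insert_right \<pi>) A"
    by (auto simp: inj_on_def insert_right_eq)
  then have "mset_set (children (pattern_class s) \<pi>) = image_mset (insert_right \<pi>) (mset_set A)"
    by (simp add: children_def A_def image_mset_mset_set)
  ultimately have "image_mset (label (pattern_class s)) (mset_set (children (pattern_class s) \<pi>))
      = image_mset (\<lambda>t. F (T t)) (mset_set A)"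
    using finA by (simp only: multiset.map_comp comp_def) (rule image_mset_cong, simp)
  also have "\<dots> = image_mset F (image_mset T (mset_set A))"
    by (simp add: multiset.map_comp comp_def)
  also have "image_mset T (mset_set A) = mset_set (SIGMA j:{1..k + 1}. {q ! (j - 1)<..q ! j})"
  proof -
    have "sorted_wrt (>) r" by (simp add: r_def sorted_wrt_rev)
    then have "bij_betw T A (SIGMA j:{1..k + 1}. {q ! (j - 1)<..q ! j})"
      using bij_betw_sites_intervals[OF finA _ refl, of r]
      by (simp add: T_def[abs_def] q_def xkp)
    then show ?thesis by (simp add: bij_betw_def image_mset_mset_set)
  qed
  also have "(SIGMA j:{1..k + 1}. {q ! (j - 1)<..q ! j}) =
      (SIGMA j:{1..k}. {(0 # p) ! (j - 1)<..(0 # p) ! j}) \<union> Pair (k + 1) ` {(0 # p) ! k<..x}"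
  proof -
    have q: "q ! j = (0 # p) ! j" if "j \<le> k" for j
      using that xkp by (simp add: q_def nth_append nth_Cons split: nat.split)
    have qk: "q ! (k + 1) = x" using xkp by (simp add: q_def nth_append)
    have "{1..k + 1} = {1..k} \<union> {k + 1}" by auto
    then have "(SIGMA j:{1..k + 1}. {q ! (j - 1)<..q ! j}) =
      (SIGMA j:{1..k}. {q ! (j - 1)<..q ! j}) \<union> (SIGMA j:{k + 1}. {q ! (j - 1)<..q ! j})"
      by (simp only: Sigma_Un_distrib1)
    also have "(SIGMA j:{1..k}. {q ! (j - 1)<..q ! j}) =
        (SIGMA j:{1..k}. {(0 # p) ! (j - 1)<..(0 # p) ! j})"
    proof (intro Sigma_cong refl)
      fix j assume "j \<in> {1..k}"
      then have "j \<le> k" "j - 1 \<le> k" by auto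
      then show "{q ! (j - 1)<..q ! j} = {(0 # p) ! (j - 1)<..(0 # p) ! j}"
        by (simp only: q)
    qed
    also have "(SIGMA j:{k + 1}. {q ! (j - 1)<..q ! j}) = Pair (k + 1) ` {(0 # p) ! k<..x}"
      using q[of k] qk by auto
    finally show ?thesis .
  qed
  also have "mset_set \<dots> = mset_set (SIGMA j:{1..k}. {(0 # p) ! (j - 1)<..(0 # p) ! j})
      + image_mset (Pair (k + 1)) (mset_set {(0 # p) ! k<..x})"
    by (subst mset_set_Union) (auto simp: image_mset_mset_set inj_on_def)
  also have "image_mset F \<dots> = successor_labels x k p"
  proof -
    have "image_mset F (mset_set (SIGMA j:{1..k}. {(0 # p) ! (j - 1)<..(0 # p) ! j})) =
        {# (2 + (0 # p) ! j, j, take (j - 1) p @ [i]).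
          (j, i) \<in># mset_set (SIGMA j:{1..k}. {(0 # p) ! (j - 1)<..(0 # p) ! j}) #}"
      by (rule image_mset_cong) (auto simp: F_def)
    moreover have "image_mset F (image_mset (Pair (k + 1)) M) = {# (x + 1, k + 1, p @ [i]). i \<in># M #}"
      for M
      using xkp(2,3) by (simp add: F_def multiset.map_comp comp_def)
    ultimately show ?thesis by (simp only: successor_labels_def image_mset_union)
  qed
  finally show ?thesis .
qed

section \<open>Deletion of the last letter and the root\<close>

text \<open>By \<open>avoids_pat_stack_sort_snoc\<close>, avoidance passes to the word without its
  last letter. Normalization is strictly monotone on the letters, so it preserves avoidance.\<close>

lemma normalize_butlast_in_pattern_class:
  assumes "\<pi> \<in> pattern_class s" "\<pi> \<noteq> []"
  shows "normalize_word (butlast \<pi>) \<in> pattern_class s"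
proof -
  define w where "w = butlast \<pi>"
  define f where "f v = card {u \<in> set w. u \<le> v}" for v
  have wa: "\<pi> = w @ [last \<pi>]" using assms(2) by (simp add: w_def)
  have "distinct (w @ [last \<pi>])" and av_snoc: "avoids (pat s) (stack_sort (w @ [last \<pi>]))"
    using assms(1) unfolding wa[symmetric] by (auto simp: pattern_class_def is_perm_iff)
  then have d: "distinct w" "last \<pi> \<notin> set w" by auto
  with av_snoc have av: "avoids (pat s) (stack_sort w)" by (simp add: avoids_pat_stack_sort_snoc)
  have f: "strict_mono_on (set w) f"
    unfolding strict_mono_on_def
  proof (intro allI impI, elim conjE)
    fix u v assume "v \<in> set w" "u < v"
    then have "v \<in> {x \<in> set w. x \<le> v} - {x \<in> set w. x \<le> u}"
      "{x \<in> set w. x \<le> u} \<subseteq> {x \<in> set w. x \<le> v}" by auto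
    then have "{x \<in> set w. x \<le> u} \<subset> {x \<in> set w. x \<le> v}" by blast
    then show "f u < f v" unfolding f_def by (intro psubset_card_mono) auto
  qed
  have N: "normalize_word w = map f w" by (simp add: normalize_word_def f_def)
  have inj: "inj_on f (set w)" using f by (rule strict_mono_on_imp_inj_on)
  \<comment> \<open>The ranks are distinct and lie in an interval of the same size, so they fill
    it.\<close>
  have "f ` set w = {1..length w}"
  proof (rule card_subset_eq)
    have "1 \<le> f v \<and> f v \<le> length w" if "v \<in> set w" for v
    proof
      have "card {v} \<le> f v" unfolding f_def using that by (intro card_mono) auto
      then show "1 \<le> f v" by simp
      have "f v \<le> card (set w)" unfolding f_def by (intro card_mono) auto
      then show "f v \<le> length w" by (simp add: distinct_card d)
    qed
    then show "f ` set w \<subseteq> {1..length w}" by auto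
  qed (simp_all add: card_image inj distinct_card d)
  then have "is_perm (map f w)"
    using d inj by (simp add: is_perm_iff distinct_map)
  moreover have "avoids (pat s) (stack_sort (map f w))"
    using d f av by (simp add: stack_sort_map avoids_pat_map)
  ultimately show ?thesis by (simp add: N pattern_class_def w_def[symmetric])
qed

lemma stack_sort_singleton: "stack_sort [a] = [a]"
  using stack_sort_append_max[of "[]" "[]" a] by simp

lemma label_singleton:
  "[1] \<in> pattern_class s" "label (pattern_class s) [1] = (2, 1, [1])"
proof -
  show mem: "[1] \<in> pattern_class s"
    by (auto simp: pattern_class_def is_perm_iff stack_sort_singleton)
  have R: "rl_maxima [1] = {1}" using rl_maxima_snoc[of "[]" 1] by simp
  \<comment> \<open>With nothing popped there is no obstructing pair, and both sites are
    active.\<close>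
  have "popped [1] = []" using R by (simp add: popped_def)
  then have "active_sites (pattern_class s) [1] = {0..1}"
    unfolding active_sites_pattern_class[OF mem] by (simp add: atLeast0AtMost atMost_def)
  moreover have "{u \<in> {0..1::nat}. 1 \<le> u} = {1}" by auto
  ultimately show "label (pattern_class s) [1] = (2, 1, [1])"
    unfolding label_eq R using sorted_list_of_set_insert_max[of "{}" "1::nat"]
    by (simp add: sites_from_def)
qed

theorem theorem3p2:
  fixes C :: "nat list set"
  assumes "C = class_SS \<or> C = class_SrS"
  shows "(\<forall>\<pi>\<in>C. length \<pi> \<ge> 2 \<longrightarrow> normalize_word (butlast \<pi>) \<in> C)
    \<and> ([1] \<in> C \<and> label C [1] = (2, 1, [1]))
    \<and> (\<forall>\<pi>\<in>C. \<forall>x k p. label C \<pi> = (x, k, p) \<longrightarrow>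
          image_mset (label C) (mset_set (children C \<pi>)) = successor_labels x k p)"
proof -
  obtain s where C: "C = pattern_class s"
    using assms class_SS_eq class_SrS_eq by blast
  show ?thesis
    unfolding C using normalize_butlast_in_pattern_class label_singleton label_children
    by (auto simp del: One_nat_def intro!: normalize_butlast_in_pattern_class)
qed

end
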